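(* Let $K$ be a field, let $J\subseteq I$ be monomial ideals in $R=K[x_1,\ldots,x_n]$, and let $1\leq j\leq n$. If $J$ is a demotion of $I$, then $J/x_j$ is a demotion of $I/x_j$.
   Context: For ideals $J\subseteq I$ in a commutative Noetherian ring $R$, $J$ is a demotion of $I$ if $I^rJ^s=I^{r+s}\cap J^s$ for all integers $r,s\geq 0$ (with $I^0=J^0=R$). For a monomial ideal $I$ with minimal set of monomial generators $\mathcal{G}(I)=\{u_1,\ldots,u_m\}$, the contraction $I/x_j$ is the monomial ideal of $K[x_i : i\neq j]$ generated by the monomials obtained from $u_1,\ldots,u_m$ by substituting $x_j=1$ (equivalently, the monomial localization of $I$ with respect to the prime ideal generated by all variables except $x_j$). *)

theory Defs
  imports "HOL-Library.Poly_Mapping" "HOL-Algebra.Ideal_Product"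
begin

text \<open>
  A polynomial in variables \<open>x\<^sub>i\<close> (\<open>i :: nat\<close>) over \<open>'k\<close> is a finitely supported map from exponent
  vectors (finitely supported maps \<open>nat \<Rightarrow>\<^sub>0 nat\<close>) to coefficients. The ring
  \<open>K[x\<^sub>i : i \<in> V]\<close> is the subring of those polynomials in which only variables from \<open>V\<close> occur,
  so that \<open>K[x\<^sub>1,\<dots>,x\<^sub>n]\<close> and \<open>K[x\<^sub>i : i \<noteq> j]\<close> are both instances.
\<close>

type_synonym 'k mpoly = "(nat \<Rightarrow>\<^sub>0 nat) \<Rightarrow>\<^sub>0 'k"

definition mpoly_ring :: "nat set \<Rightarrow> ('k::field) mpoly ring" where
  "mpoly_ring V =
     \<lparr>carrier = {p. \<forall>m \<in> Poly_Mapping.keys p. Poly_Mapping.keys m \<subseteq> V},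
      monoid.mult = (*), one = 1, zero = 0, add = (+)\<rparr>"

abbreviation monomial :: "(nat \<Rightarrow>\<^sub>0 nat) \<Rightarrow> ('k::field) mpoly" where
  "monomial m \<equiv> Poly_Mapping.single m 1"

definition monomials :: "nat set \<Rightarrow> ('k::field) mpoly set" where
  "monomials V = monomial ` {m. Poly_Mapping.keys m \<subseteq> V}"

definition monomial_ideal :: "nat set \<Rightarrow> ('k::field) mpoly set \<Rightarrow> bool" where
  "monomial_ideal V I \<longleftrightarrow> (\<exists>S \<subseteq> monomials V. I = Idl\<^bsub>mpoly_ring V\<^esub> S)"

definition is_min_monomial_gens ::
    "nat set \<Rightarrow> ('k::field) mpoly set \<Rightarrow> 'k mpoly set \<Rightarrow> bool" where
  "is_min_monomial_gens V I G \<longleftrightarrow>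
     G \<subseteq> monomials V \<and> Idl\<^bsub>mpoly_ring V\<^esub> G = I \<and>
     (\<forall>H. H \<subset> G \<longrightarrow> Idl\<^bsub>mpoly_ring V\<^esub> H \<noteq> I)"

text \<open>Well-defined for every monomial ideal: see \<open>ex1_min_monomial_gens\<close> below.\<close>

definition min_monomial_gens :: "nat set \<Rightarrow> ('k::field) mpoly set \<Rightarrow> 'k mpoly set" where
  "min_monomial_gens V I = (THE G. is_min_monomial_gens V I G)"

text \<open>
  Setting \<open>x\<^sub>j = 1\<close> turns \<open>x\<^sup>m\<close> into the monomial in which the exponent of \<open>x\<^sub>j\<close> is reset to \<open>0\<close>.
\<close>

definition subst_one :: "nat \<Rightarrow> ('k::field) mpoly \<Rightarrow> 'k mpoly" where
  "subst_one j p =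
     (\<Sum>m \<in> Poly_Mapping.keys p.
        Poly_Mapping.single (Poly_Mapping.update j 0 m) (Poly_Mapping.lookup p m))"

text \<open>The contraction \<open>I/x\<^sub>j\<close> of a monomial ideal \<open>I\<close> of \<open>K[x\<^sub>i : i \<in> V]\<close>.\<close>

definition contraction :: "nat set \<Rightarrow> nat \<Rightarrow> ('k::field) mpoly set \<Rightarrow> 'k mpoly set" where
  "contraction V j I = Idl\<^bsub>mpoly_ring (V - {j})\<^esub> (subst_one j ` min_monomial_gens V I)"

text \<open>
  Intended for commutative Noetherian rings \<open>R\<close>. Powers of ideals are taken in the multiplicative
  monoid of ideals of \<open>R\<close>, whose unit is \<open>carrier R\<close>; hence \<open>I\<^sup>0 = R\<close>.
\<close>

definition demotion :: "('a, 'b) ring_scheme \<Rightarrow> 'a set \<Rightarrow> 'a set \<Rightarrow> bool" where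
  "demotion R J I \<longleftrightarrow>
     ideal J R \<and> ideal I R \<and> J \<subseteq> I \<and>
     (\<forall>r s :: nat.
        (I [^]\<^bsub>ideals_set R\<^esub> r) \<cdot>\<^bsub>R\<^esub> (J [^]\<^bsub>ideals_set R\<^esub> s) =
        (I [^]\<^bsub>ideals_set R\<^esub> (r + s)) \<inter> (J [^]\<^bsub>ideals_set R\<^esub> s))"


section \<open>Well-definedness\<close>

lemma mpoly_ring_simps [simp]:
  "p \<in> carrier (mpoly_ring V) \<longleftrightarrow> (\<forall>m \<in> Poly_Mapping.keys p. Poly_Mapping.keys m \<subseteq> V)"
  "p \<otimes>\<^bsub>mpoly_ring V\<^esub> q = p * q" "p \<oplus>\<^bsub>mpoly_ring V\<^esub> q = p + q"
  "\<one>\<^bsub>mpoly_ring V\<^esub> = 1" "\<zero>\<^bsub>mpoly_ring V\<^esub> = 0"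
  by (auto simp: mpoly_ring_def)

lemma keys_plus_nat:
  "Poly_Mapping.keys (a + b :: nat \<Rightarrow>\<^sub>0 nat) = Poly_Mapping.keys a \<union> Poly_Mapping.keys b"
  by (auto simp: in_keys_iff lookup_add)

lemma mult_keysE:
  assumes "m \<in> Poly_Mapping.keys (p * q :: ('k::field) mpoly)"
  obtains a b where "a \<in> Poly_Mapping.keys p" "b \<in> Poly_Mapping.keys q" "m = a + b"
  using keys_mult[of p q] assms by blast

lemma add_keysD:
  "m \<in> Poly_Mapping.keys (p + q :: ('k::field) mpoly) \<Longrightarrow>
   m \<in> Poly_Mapping.keys p \<or> m \<in> Poly_Mapping.keys q"
  using Poly_Mapping.keys_add[of p q] by blast

lemma cring_mpoly_ring: "cring (mpoly_ring V :: ('k::field) mpoly ring)"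
proof (rule cringI)
  show "abelian_group (mpoly_ring V :: 'k mpoly ring)"
  proof (rule abelian_groupI)
    fix x :: "'k mpoly" assume "x \<in> carrier (mpoly_ring V)"
    thus "\<exists>y\<in>carrier (mpoly_ring V). y \<oplus>\<^bsub>mpoly_ring V\<^esub> x = \<zero>\<^bsub>mpoly_ring V\<^esub>"
      by (intro bexI[of _ "- x"]) auto
  qed (auto simp: algebra_simps dest!: add_keysD)
  show "comm_monoid (mpoly_ring V :: 'k mpoly ring)"
  proof (rule comm_monoidI)
    fix p q :: "'k mpoly"
    assume "p \<in> carrier (mpoly_ring V)" "q \<in> carrier (mpoly_ring V)"
    thus "p \<otimes>\<^bsub>mpoly_ring V\<^esub> q \<in> carrier (mpoly_ring V)"
      by (auto simp: keys_plus_nat subset_iff elim!: mult_keysE)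
  qed (simp_all add: mult.assoc mult.commute)
qed (auto simp: algebra_simps)

text \<open>The polynomials all of whose monomials are divisible by a monomial with exponent in \<open>S\<close>.\<close>

definition mspan :: "nat set \<Rightarrow> (nat \<Rightarrow>\<^sub>0 nat) set \<Rightarrow> ('k::field) mpoly set" where
  "mspan V S = {p \<in> carrier (mpoly_ring V). \<forall>m \<in> Poly_Mapping.keys p. \<exists>a \<in> S. \<exists>c. m = a + c}"

lemma ideal_mspan: "ideal (mspan V S :: ('k::field) mpoly set) (mpoly_ring V)"
proof -
  interpret R: cring "mpoly_ring V :: 'k mpoly ring" by (rule cring_mpoly_ring)
  have mult: "x * p \<in> mspan V S" if p: "p \<in> mspan V S" and x: "x \<in> carrier (mpoly_ring V)"
    for p x :: "'k mpoly"
  proof -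
    have "x * p \<in> carrier (mpoly_ring V)"
      using R.m_closed[of x p] p x by (simp add: mspan_def)
    moreover have "\<exists>a \<in> S. \<exists>c. m = a + c" if m: "m \<in> Poly_Mapping.keys (x * p)" for m
    proof -
      obtain u v where uv: "v \<in> Poly_Mapping.keys p" "m = u + v"
        using m by (elim mult_keysE)
      then obtain a c where "a \<in> S" "v = a + c" using p by (auto simp: mspan_def)
      with uv have "m = a + (u + c)" by (simp add: algebra_simps)
      with \<open>a \<in> S\<close> show ?thesis by blast
    qed
    ultimately show ?thesis unfolding mspan_def by blast
  qed
  have inv: "inv\<^bsub>add_monoid (mpoly_ring V)\<^esub> p = - p" if "p \<in> carrier (mpoly_ring V)"
    for p :: "'k mpoly"
    using R.minus_equality[of "- p" p] that by (simp add: a_inv_def)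
  show ?thesis
  proof (rule idealI)
    show "subgroup (mspan V S) (add_monoid (mpoly_ring V :: 'k mpoly ring))"
    proof
      fix x :: "'k mpoly" assume "x \<in> mspan V S"
      moreover from this have "x \<in> carrier (mpoly_ring V)" by (simp add: mspan_def)
      ultimately show "inv\<^bsub>add_monoid (mpoly_ring V)\<^esub> x \<in> mspan V S"
        by (subst inv) (auto simp: mspan_def)
    qed (auto simp: mspan_def dest!: add_keysD)
  next
    fix a x :: "'k mpoly" assume "a \<in> mspan V S" "x \<in> carrier (mpoly_ring V)"
    from mult[OF this]
    show "x \<otimes>\<^bsub>mpoly_ring V\<^esub> a \<in> mspan V S" "a \<otimes>\<^bsub>mpoly_ring V\<^esub> x \<in> mspan V S"
      by (simp_all add: mult.commute)
  qed (rule R.ring_axioms)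
qed

lemma genideal_monomials:
  assumes S: "\<And>a. a \<in> S \<Longrightarrow> Poly_Mapping.keys a \<subseteq> V"
  shows "Idl\<^bsub>mpoly_ring V\<^esub> (monomial ` S) = (mspan V S :: ('k::field) mpoly set)"
proof
  interpret R: cring "mpoly_ring V :: 'k mpoly ring" by (rule cring_mpoly_ring)
  have car: "monomial ` S \<subseteq> carrier (mpoly_ring V :: 'k mpoly ring)"
    using S by (simp add: image_subset_iff)
  have "\<exists>a'\<in>S. \<exists>c. a = a' + c" if "a \<in> S" for a
    using that by (intro bexI[of _ a] exI[of _ 0]) simp_all
  hence "monomial ` S \<subseteq> (mspan V S :: 'k mpoly set)"
    using S by (simp add: mspan_def image_subset_iff)
  thus "Idl\<^bsub>mpoly_ring V\<^esub> (monomial ` S) \<subseteq> (mspan V S :: 'k mpoly set)"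
    by (intro R.genideal_minimal ideal_mspan)
  let ?I = "Idl\<^bsub>mpoly_ring V\<^esub> (monomial ` S) :: 'k mpoly set"
  interpret I: ideal ?I "mpoly_ring V :: 'k mpoly ring"
    by (rule R.genideal_ideal[OF car])
  show "mspan V S \<subseteq> ?I"
  proof
    fix p :: "'k mpoly" assume p: "p \<in> mspan V S"
    have single: "Poly_Mapping.single m b \<in> ?I" if m: "m \<in> Poly_Mapping.keys p" for m b
    proof -
      obtain a c where ac: "a \<in> S" "m = a + c" using p m by (auto simp: mspan_def)
      have "Poly_Mapping.keys m \<subseteq> V" using p m by (auto simp: mspan_def)
      hence "(Poly_Mapping.single c b :: 'k mpoly) \<in> carrier (mpoly_ring V)"
        using ac by (auto simp: keys_plus_nat)
      moreover have "monomial a \<in> ?I" using R.genideal_self[OF car] ac by blast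
      ultimately have "Poly_Mapping.single c b \<otimes>\<^bsub>mpoly_ring V\<^esub> monomial a \<in> ?I"
        by (rule I.I_l_closed[rotated])
      thus ?thesis using ac by (simp add: mult_single add.commute)
    qed
    have "(\<Sum>m\<in>A. Poly_Mapping.single m (Poly_Mapping.lookup p m)) \<in> ?I"
      if "finite A" "A \<subseteq> Poly_Mapping.keys p" for A
      using that
    proof (induction A rule: finite_induct)
      case empty
      show ?case using I.zero_closed by simp
    next
      case (insert m A)
      thus ?case using I.a_closed[OF single[of m "Poly_Mapping.lookup p m"]] by simp
    qed
    from this[OF finite_keys order_refl]
    have "(\<Sum>m\<in>Poly_Mapping.keys p.
              Poly_Mapping.single m (Poly_Mapping.lookup p m)) \<in> ?I"
      .
    also have "(\<Sum>m\<in>Poly_Mapping.keys p.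
              Poly_Mapping.single m (Poly_Mapping.lookup p m)) = p"
      by (rule poly_mapping_eqI)
         (simp add: lookup_sum lookup_single when_def in_keys_iff)
    finally show "p \<in> ?I" .
  qed
qed

lemma ex1_min_monomial_gens:
  fixes I :: "('k::field) mpoly set"
  assumes "monomial_ideal V I"
  shows "\<exists>!G. is_min_monomial_gens V I G"
proof -
  obtain S0 where S0: "S0 \<subseteq> monomials V" "I = Idl\<^bsub>mpoly_ring V\<^esub> S0"
    using assms by (auto simp: monomial_ideal_def)
  then obtain S where S: "S \<subseteq> {m. Poly_Mapping.keys m \<subseteq> V}" "S0 = monomial ` S"
    unfolding monomials_def by (meson subset_imageE)
  have I: "I = mspan V S" using S S0 genideal_monomials[of S V] by auto
  have inj: "inj (monomial :: _ \<Rightarrow> 'k mpoly)"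
    by (rule injI) (metis keys_single singleton_inject zero_neq_one)
  have mem: "(monomial m :: 'k mpoly) \<in> mspan V T \<longleftrightarrow>
      Poly_Mapping.keys m \<subseteq> V \<and> (\<exists>a\<in>T. \<exists>c. m = a + c)" for m T
    by (auto simp: mspan_def)
  define deg where "deg = (\<lambda>m :: nat \<Rightarrow>\<^sub>0 nat. \<Sum>i\<in>Poly_Mapping.keys m. Poly_Mapping.lookup m i)"
  have deg_add: "deg a < deg (a + c)" if nz: "c \<noteq> 0" for a c
  proof -
    have split: "deg m = (\<Sum>i\<in>Poly_Mapping.keys (a + c). Poly_Mapping.lookup m i)"
      if "m \<in> {a, c}" for m
      unfolding deg_def using that
      by (intro sum.mono_neutral_left) (auto simp: keys_plus_nat in_keys_iff)
    obtain i where "Poly_Mapping.lookup c i \<noteq> 0" using nz by (metis lookup_zero poly_mapping_eqI)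
    hence "deg c > 0" unfolding deg_def
      by (intro sum_pos2[of _ i]) (auto simp: in_keys_iff)
    moreover have "deg (a + c) = deg a + deg c"
      using split[of a] split[of c] by (simp add: deg_def lookup_add sum.distrib)
    ultimately show ?thesis by simp
  qed
  define M where "M = {m \<in> S. \<forall>a\<in>S. \<forall>c. m = a + c \<longrightarrow> a = m}"
  have below: "\<exists>b\<in>M. \<exists>c. m = b + c" if "m \<in> S" for m
    using that
  proof (induction "deg m" arbitrary: m rule: less_induct)
    case less
    show ?case
    proof (cases "m \<in> M")
      case True thus ?thesis by (intro bexI exI[of _ 0]) auto
    next
      case False
      then obtain a c where a: "a \<in> S" "m = a + c" "a \<noteq> m" using less.prems by (auto simp: M_def)
      hence "deg a < deg m" using deg_add[of c a] by auto
      from less.hyps[OF this a(1)] obtain b d where "b \<in> M" "a = b + d" by blast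
      thus ?thesis using a by (metis add.assoc)
    qed
  qed
  have MS: "M \<subseteq> S" by (auto simp: M_def)
  have "(\<exists>a\<in>M. \<exists>c. m = a + c) \<longleftrightarrow> (\<exists>a\<in>S. \<exists>c. m = a + c)" for m
  proof
    assume "\<exists>a\<in>S. \<exists>c. m = a + c"
    then obtain a c where a: "a \<in> S" "m = a + c" by blast
    then obtain b d where "b \<in> M" "a = b + d" using below by blast
    with a have "m = b + (d + c)" by (simp add: add.assoc)
    with \<open>b \<in> M\<close> show "\<exists>a\<in>M. \<exists>c. m = a + c" by blast
  qed (use MS in blast)
  hence M_span: "mspan V M = I"
    unfolding I mspan_def by simp
  have gen: "Idl\<^bsub>mpoly_ring V\<^esub> (monomial ` T) = (mspan V T :: 'k mpoly set)"
    if "T \<subseteq> {m. Poly_Mapping.keys m \<subseteq> V}" for T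
    using that by (intro genideal_monomials) auto
  have MT: "M \<subseteq> T" if T: "(mspan V T :: 'k mpoly set) = I" "T \<subseteq> {m. Poly_Mapping.keys m \<subseteq> V}" for T
  proof
    fix a assume a: "a \<in> M"
    hence "(monomial a :: 'k mpoly) \<in> mspan V T"
      unfolding T I mem using S MS by (auto intro!: bexI exI[of _ 0])
    then obtain t c where t: "t \<in> T" "a = t + c" by (auto simp: mem)
    have "(monomial t :: 'k mpoly) \<in> mspan V S"
      unfolding I[symmetric] T(1)[symmetric] mem using t T by (auto intro!: bexI exI[of _ 0])
    then obtain s d where s: "s \<in> S" "t = s + d" by (auto simp: mem)
    have "a = s + (d + c)" using s t by (simp add: add.assoc)
    moreover from this have "s = a" using a s by (auto simp: M_def)
    ultimately have "d + c = 0" by simp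
    hence "c = 0" using deg_add[of c d] by (cases "c = 0") (auto simp: deg_def)
    thus "a \<in> T" using t by simp
  qed
  have MV: "M \<subseteq> {m. Poly_Mapping.keys m \<subseteq> V}" using MS S by blast
  show ?thesis
  proof (rule ex1I[of _ "monomial ` M"])
    show "is_min_monomial_gens V I (monomial ` M)"
      unfolding is_min_monomial_gens_def
    proof (intro conjI allI impI)
      fix H :: "'k mpoly set" assume H: "H \<subset> monomial ` M"
      then obtain T where T: "T \<subseteq> M" "H = monomial ` T" by (meson subset_imageE psubsetE)
      show "Idl\<^bsub>mpoly_ring V\<^esub> H \<noteq> I"
        using MT[of T] gen[of T] T MV H by auto
    qed (use MV gen[OF MV] M_span in \<open>auto simp: monomials_def\<close>)
  next
    fix G assume G: "is_min_monomial_gens V I G"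
    then obtain T where T: "T \<subseteq> {m. Poly_Mapping.keys m \<subseteq> V}" "G = monomial ` T"
      unfolding is_min_monomial_gens_def monomials_def by (meson subset_imageE)
    have "mspan V T = I" using G gen[OF T(1)] T by (auto simp: is_min_monomial_gens_def)
    hence "monomial ` M \<subseteq> G" using MT T by blast
    moreover have "Idl\<^bsub>mpoly_ring V\<^esub> (monomial ` M) = I" using gen[OF MV] M_span by simp
    ultimately show "G = monomial ` M"
      using G unfolding is_min_monomial_gens_def by blast
  qed
qed

end

theory Submission
  imports Defs "HOL-Library.Set_Algebras"
begin

text \<open>
  A monomial ideal of \<open>K[x\<^sub>i : i \<in> V]\<close> is determined by the exponents of its monomials. If \<open>A\<close>
  is the set of exponents of some monomial generators, these are the vectors in \<open>A + UNIV\<close> with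
  support in \<open>V\<close>. Products of monomial ideals correspond to Minkowski sums of generating exponent
  sets, and intersections to intersections of the sets \<open>A + UNIV\<close>. As
  \<open>I\<^sup>r J\<^sup>s \<subseteq> I\<^sup>r\<^sup>+\<^sup>s \<inter> J\<^sup>s\<close> whenever \<open>J \<subseteq> I\<close>, being a demotion becomes one implication between
  memberships of a single exponent vector (\<open>demotion_mspan_iff\<close>).

  In these terms the contraction resets the \<open>j\<close>-th coordinate of every generator to \<open>0\<close>, which is
  additive and therefore commutes with Minkowski sums. Moreover a monomial \<open>u\<close> free of \<open>x\<^sub>j\<close> lies
  in the contraction of a monomial ideal iff \<open>x\<^sub>j\<^sup>N u\<close> lies in the ideal itself for some
  \<open>N\<close> (\<open>mem_image_update_iff\<close>): contraction is localization at \<open>x\<^sub>j\<close>. So if \<open>u\<close>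
  lies in \<open>(I/x\<^sub>j)\<^sup>r\<^sup>+\<^sup>s \<inter> (J/x\<^sub>j)\<^sup>s\<close>, then \<open>x\<^sub>j\<^sup>N u\<close> lies in
  \<open>I\<^sup>r\<^sup>+\<^sup>s \<inter> J\<^sup>s = I\<^sup>r J\<^sup>s\<close> for \<open>N\<close> large, and setting \<open>x\<^sub>j = 1\<close> puts \<open>u\<close> into
  \<open>(I/x\<^sub>j)\<^sup>r (J/x\<^sub>j)\<^sup>s\<close>.
\<close>

section \<open>Minkowski sums of exponent sets\<close>

abbreviation nfold_sum :: "nat \<Rightarrow> 'a::comm_monoid_add set \<Rightarrow> 'a set" where
  "nfold_sum r A \<equiv> (\<Sum>_<r. A)"

lemma nfold_sum_add: "nfold_sum (r + s) A = nfold_sum r A + nfold_sum s A"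
  by (induction s) (simp_all add: ac_simps)

lemma set_plus_UNIV_UNIV: "A + UNIV + UNIV = (A + UNIV :: 'a::comm_monoid_add set)"
  by (metis (no_types, lifting) UNIV_I add.assoc set_zero_plus2 top.extremum_uniqueI)

lemma mem_plus_UNIV_addI: "m \<in> A + UNIV \<Longrightarrow> m + c \<in> A + (UNIV :: 'a::comm_monoid_add set)"
  using set_plus_intro[of m "A + UNIV" c UNIV] by (simp add: set_plus_UNIV_UNIV)

lemma plus_UNIV_mono:
  assumes "A \<subseteq> C + (UNIV :: 'a::comm_monoid_add set)" "B \<subseteq> D + UNIV"
  shows "A + B \<subseteq> C + D + UNIV"
proof -
  have "A + B \<subseteq> (C + UNIV) + (D + UNIV)" by (rule set_plus_mono2[OF assms])
  also have "\<dots> = C + D + UNIV + UNIV" by (simp add: ac_simps)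
  finally show ?thesis by (simp only: set_plus_UNIV_UNIV)
qed

lemma subset_plus_UNIV: "A \<subseteq> A + (UNIV :: 'a::comm_monoid_add set)"
  using set_zero_plus2[of UNIV A] by (simp add: add.commute)

lemma nfold_sum_mono:
  assumes "T \<subseteq> S + (UNIV :: 'a::comm_monoid_add set)"
  shows "nfold_sum s T \<subseteq> nfold_sum s S + UNIV"
  by (induction s) (use plus_UNIV_mono[OF _ assms] in simp_all)

section \<open>Arithmetic of monomial ideals\<close>

lemma mem_mspan:
  "p \<in> mspan V A \<longleftrightarrow> p \<in> carrier (mpoly_ring V) \<and> Poly_Mapping.keys p \<subseteq> A + UNIV"
  by (auto simp: mspan_def set_plus_def subset_iff)

lemma mspan_subset_iff:
  "(mspan V A :: ('k::field) mpoly set) \<subseteq> mspan V B \<longleftrightarrow>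
     (\<forall>m. Poly_Mapping.keys m \<subseteq> V \<longrightarrow> m \<in> A + UNIV \<longrightarrow> m \<in> B + UNIV)"
proof (intro iffI allI impI)
  fix m assume "(mspan V A :: 'k mpoly set) \<subseteq> mspan V B" "Poly_Mapping.keys m \<subseteq> V"
    "m \<in> A + UNIV"
  moreover from this have "(monomial m :: 'k mpoly) \<in> mspan V A" by (simp add: mem_mspan)
  ultimately have "(monomial m :: 'k mpoly) \<in> mspan V B" by blast
  thus "m \<in> B + UNIV" by (simp add: mem_mspan)
next
  assume "\<forall>m. Poly_Mapping.keys m \<subseteq> V \<longrightarrow> m \<in> A + UNIV \<longrightarrow> m \<in> B + UNIV"
  thus "(mspan V A :: 'k mpoly set) \<subseteq> mspan V B" by (auto simp: mem_mspan subset_iff)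
qed

abbreviation exponents :: "nat set \<Rightarrow> (nat \<Rightarrow>\<^sub>0 nat) set" where
  "exponents V \<equiv> {m. Poly_Mapping.keys m \<subseteq> V}"

lemma set_plus_exponents:
  "A \<subseteq> exponents V \<Longrightarrow> B \<subseteq> exponents V \<Longrightarrow> A + B \<subseteq> exponents V"
  by (auto simp: set_plus_def keys_plus_nat subset_iff)

lemma nfold_sum_exponents: "A \<subseteq> exponents V \<Longrightarrow> nfold_sum r A \<subseteq> exponents V"
  by (induction r) (simp_all add: set_plus_exponents)

lemma ideal_prod_mspan:
  assumes A: "A \<subseteq> exponents V" and B: "B \<subseteq> exponents V"
  shows "mspan V A \<cdot>\<^bsub>mpoly_ring V\<^esub> mspan V B = (mspan V (A + B) :: ('k::field) mpoly set)"
proof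
  interpret R: cring "mpoly_ring V :: 'k mpoly ring" by (rule cring_mpoly_ring)
  interpret AB: ideal "mspan V (A + B) :: 'k mpoly set" "mpoly_ring V" by (rule ideal_mspan)
  show "mspan V A \<cdot>\<^bsub>mpoly_ring V\<^esub> mspan V B \<subseteq> (mspan V (A + B) :: 'k mpoly set)"
  proof
    fix x :: "'k mpoly" assume "x \<in> mspan V A \<cdot>\<^bsub>mpoly_ring V\<^esub> mspan V B"
    thus "x \<in> mspan V (A + B)"
    proof induction
      case (prod p q)
      have "Poly_Mapping.keys (p * q) \<subseteq> Poly_Mapping.keys p + Poly_Mapping.keys q"
        using keys_mult[of p q] by (fastforce simp: set_plus_def)
      also have "\<dots> \<subseteq> A + B + UNIV"
        using prod by (intro plus_UNIV_mono) (auto simp: mem_mspan)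
      finally show ?case
        using R.m_closed[of p q] prod unfolding mem_mspan by simp
    next
      case (sum p q)
      from AB.a_closed[OF sum.IH] show ?case .
    qed
  qed
  have "ideal (mspan V A \<cdot>\<^bsub>mpoly_ring V\<^esub> mspan V B :: 'k mpoly set) (mpoly_ring V)"
    by (intro R.ideal_prod_is_ideal ideal_mspan)
  moreover have "monomial ` (A + B) \<subseteq> (mspan V A \<cdot>\<^bsub>mpoly_ring V\<^esub> mspan V B :: 'k mpoly set)"
  proof safe
    fix m assume "m \<in> A + B"
    then obtain a b where ab: "m = a + b" "a \<in> A" "b \<in> B" by (rule set_plus_elim)
    have "(monomial a :: 'k mpoly) \<in> mspan V A" "(monomial b :: 'k mpoly) \<in> mspan V B"
      using ab A B subsetD[OF subset_plus_UNIV ab(2)] subsetD[OF subset_plus_UNIV ab(3)]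
      by (auto simp: mem_mspan)
    from ideal_prod.prod[OF this, of "mpoly_ring V"]
    show "(monomial m :: 'k mpoly) \<in> mspan V A \<cdot>\<^bsub>mpoly_ring V\<^esub> mspan V B"
      by (simp add: ab mult_single)
  qed
  ultimately show "(mspan V (A + B) :: 'k mpoly set) \<subseteq> mspan V A \<cdot>\<^bsub>mpoly_ring V\<^esub> mspan V B"
    using R.genideal_minimal genideal_monomials[of "A + B" V, where 'k = 'k]
      set_plus_exponents[OF A B] by blast
qed

lemma ideal_pow_mspan:
  assumes "A \<subseteq> exponents V"
  shows "mspan V A [^]\<^bsub>ideals_set (mpoly_ring V)\<^esub> r =
         (mspan V (nfold_sum r A) :: ('k::field) mpoly set)"
proof (induction r)
  case 0
  have "m \<in> {0} + (UNIV :: (nat \<Rightarrow>\<^sub>0 nat) set)" for m by simp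
  thus ?case by (auto simp: mem_mspan ideals_set_def)
next
  case (Suc r)
  hence "mspan V A [^]\<^bsub>ideals_set (mpoly_ring V)\<^esub> Suc r =
         (mspan V (nfold_sum r A) \<cdot>\<^bsub>mpoly_ring V\<^esub> mspan V A :: 'k mpoly set)"
    by (simp add: ideals_set_def)
  thus ?case
    using assms by (simp add: ideal_prod_mspan nfold_sum_exponents)
qed

text \<open>
  The inclusion \<open>I\<^sup>r J\<^sup>s \<subseteq> I\<^sup>r\<^sup>+\<^sup>s \<inter> J\<^sup>s\<close> follows from \<open>J \<subseteq> I\<close>, and the opposite one may be tested on
  monomials because both sides are monomial ideals.
\<close>

lemma demotion_mspan_iff:
  assumes S: "S \<subseteq> exponents V" and T: "T \<subseteq> exponents V"
  shows "demotion (mpoly_ring V) (mspan V T :: ('k::field) mpoly set) (mspan V S) \<longleftrightarrow>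
    T \<subseteq> S + UNIV \<and>
    (\<forall>r s m. Poly_Mapping.keys m \<subseteq> V \<longrightarrow>
       m \<in> nfold_sum (r + s) S + UNIV \<longrightarrow> m \<in> nfold_sum s T + UNIV \<longrightarrow>
       m \<in> nfold_sum r S + nfold_sum s T + UNIV)"
    (is "?D \<longleftrightarrow> ?sub \<and> ?cond")
proof -
  let ?span = "mspan V :: _ \<Rightarrow> 'k mpoly set"
  have closed: "(A + UNIV) \<inter> (B + UNIV) + UNIV = (A + UNIV) \<inter> (B + UNIV)"
    for A B :: "(nat \<Rightarrow>\<^sub>0 nat) set"
    using subset_plus_UNIV[of "(A + UNIV) \<inter> (B + UNIV)"]
    by (auto elim!: set_plus_elim[of _ "_ \<inter> _"] intro: mem_plus_UNIV_addI)
  have inter: "?span A \<inter> ?span B = ?span ((A + UNIV) \<inter> (B + UNIV))" for A B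
    by (auto simp: mem_mspan closed)
  have sub: "?span T \<subseteq> ?span S \<longleftrightarrow> ?sub"
  proof
    assume "?span T \<subseteq> ?span S"
    thus ?sub using T subset_plus_UNIV[of T] unfolding mspan_subset_iff by blast
  next
    assume ?sub
    hence "T + UNIV \<subseteq> S + UNIV"
      by (metis order_refl set_plus_UNIV_UNIV set_plus_mono2)
    thus "?span T \<subseteq> ?span S" unfolding mspan_subset_iff by blast
  qed
  have le: "?span (nfold_sum r S + nfold_sum s T) \<subseteq>
      ?span (nfold_sum (r + s) S) \<inter> ?span (nfold_sum s T)" if ?sub for r s
  proof -
    have "nfold_sum r S + nfold_sum s T + UNIV \<subseteq> nfold_sum (r + s) S + UNIV"
      using set_plus_mono2[OF plus_UNIV_mono[OF subset_plus_UNIV nfold_sum_mono[OF that]] order_refl]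
      by (metis nfold_sum_add set_plus_UNIV_UNIV)
    moreover have "nfold_sum r S + nfold_sum s T + UNIV \<subseteq> nfold_sum s T + UNIV"
      using set_plus_mono2[of "nfold_sum s T + UNIV" "nfold_sum s T + UNIV" "nfold_sum r S" UNIV]
      unfolding set_plus_UNIV_UNIV by (simp add: ac_simps)
    ultimately show ?thesis by (auto simp: mspan_subset_iff)
  qed
  have "?D \<longleftrightarrow> ?sub \<and> (\<forall>r s. ?span (nfold_sum r S + nfold_sum s T) =
      ?span (nfold_sum (r + s) S) \<inter> ?span (nfold_sum s T))"
    unfolding demotion_def ideal_pow_mspan[OF S] ideal_pow_mspan[OF T]
      ideal_prod_mspan[OF nfold_sum_exponents[OF S] nfold_sum_exponents[OF T]]
    by (simp add: ideal_mspan sub)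
  also have "\<dots> \<longleftrightarrow> ?sub \<and> (\<forall>r s. ?span (nfold_sum (r + s) S) \<inter> ?span (nfold_sum s T) \<subseteq>
      ?span (nfold_sum r S + nfold_sum s T))"
    using le by blast
  also have "\<dots> \<longleftrightarrow> ?sub \<and> ?cond"
    unfolding inter mspan_subset_iff closed by auto
  finally show ?thesis .
qed

section \<open>Contraction as localization\<close>

lemma update_zero_plus:
  "Poly_Mapping.update j 0 (a + b :: nat \<Rightarrow>\<^sub>0 nat) =
     Poly_Mapping.update j 0 a + Poly_Mapping.update j 0 b"
  by (rule poly_mapping_eqI) (simp add: lookup_update lookup_add)

lemma update_zero_plus_single:
  "Poly_Mapping.update j 0 m + Poly_Mapping.single j (Poly_Mapping.lookup m j) =
     (m :: nat \<Rightarrow>\<^sub>0 nat)"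
  by (rule poly_mapping_eqI) (simp add: lookup_update lookup_add lookup_single when_def)

lemma update_zero_single: "Poly_Mapping.update j 0 (Poly_Mapping.single j N :: nat \<Rightarrow>\<^sub>0 nat) = 0"
  by (rule poly_mapping_eqI) (simp add: lookup_update lookup_single when_def)

lemma update_zero_id:
  "j \<notin> Poly_Mapping.keys m \<Longrightarrow> Poly_Mapping.update j 0 m = (m :: nat \<Rightarrow>\<^sub>0 nat)"
  by (rule poly_mapping_eqI) (auto simp: lookup_update in_keys_iff)

lemma image_update_exponents:
  "A \<subseteq> exponents V \<Longrightarrow> Poly_Mapping.update j 0 ` A \<subseteq> exponents (V - {j})"
  unfolding image_subset_iff mem_Collect_eq keys_update by auto

lemma image_update_plus:
  "Poly_Mapping.update j 0 ` (A + B :: (nat \<Rightarrow>\<^sub>0 nat) set) =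
     Poly_Mapping.update j 0 ` A + Poly_Mapping.update j 0 ` B"
  (is "?u ` _ = _")
proof -
  have "?u ` (A + B) = (\<lambda>(a, b). ?u a + ?u b) ` (A \<times> B)"
    by (simp add: set_plus_image image_image case_prod_unfold update_zero_plus)
  thus ?thesis by (force simp: set_plus_image)
qed

lemma image_update_nfold_sum:
  "Poly_Mapping.update j 0 ` nfold_sum r (A :: (nat \<Rightarrow>\<^sub>0 nat) set) =
     nfold_sum r (Poly_Mapping.update j 0 ` A)"
  by (induction r) (simp_all add: image_update_plus update_zero_id)

text \<open>
  With \<open>A\<close> the generating exponents of \<open>I\<close>, this reads \<open>I/x\<^sub>j = (I : x\<^sub>j\<^sup>\<infinity>) \<inter> K[x\<^sub>i : i \<noteq> j]\<close> on
  monomials: a power of \<open>x\<^sub>j\<close> restores the factors that setting \<open>x\<^sub>j = 1\<close> has removed from a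
  generator.
\<close>

lemma mem_image_update_iff:
  assumes "j \<notin> Poly_Mapping.keys m"
  shows "m \<in> Poly_Mapping.update j 0 ` A + UNIV \<longleftrightarrow>
         (\<exists>N. m + Poly_Mapping.single j N \<in> A + (UNIV :: (nat \<Rightarrow>\<^sub>0 nat) set))"
proof
  assume "m \<in> Poly_Mapping.update j 0 ` A + UNIV"
  then obtain a c where a: "a \<in> A" and m: "m = Poly_Mapping.update j 0 a + c"
    by (auto elim!: set_plus_elim)
  have "m + Poly_Mapping.single j (Poly_Mapping.lookup a j) =
      (Poly_Mapping.update j 0 a + Poly_Mapping.single j (Poly_Mapping.lookup a j)) + c"
    by (simp add: m ac_simps)
  also have "\<dots> = a + c" by (simp only: update_zero_plus_single)
  finally show "\<exists>N. m + Poly_Mapping.single j N \<in> A + UNIV"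
    using set_plus_intro[OF a UNIV_I, of c] by metis
next
  assume "\<exists>N. m + Poly_Mapping.single j N \<in> A + UNIV"
  then obtain N a c where a: "a \<in> A" and eq: "m + Poly_Mapping.single j N = a + c"
    by (auto elim!: set_plus_elim)
  have "m = Poly_Mapping.update j 0 (m + Poly_Mapping.single j N)"
    by (simp add: update_zero_plus update_zero_single update_zero_id[OF assms])
  also have "\<dots> = Poly_Mapping.update j 0 a + Poly_Mapping.update j 0 c"
    by (simp add: eq update_zero_plus)
  finally have "m = Poly_Mapping.update j 0 a + Poly_Mapping.update j 0 c" .
  thus "m \<in> Poly_Mapping.update j 0 ` A + UNIV"
    using set_plus_intro[OF imageI[OF a] UNIV_I] by metis
qed

lemma contraction_mspan:
  fixes I :: "('k::field) mpoly set"
  assumes "monomial_ideal V I"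
  obtains S where "S \<subseteq> exponents V" "I = mspan V S"
    "contraction V j I = mspan (V - {j}) (Poly_Mapping.update j 0 ` S)"
proof -
  have "is_min_monomial_gens V I (min_monomial_gens V I)"
    unfolding min_monomial_gens_def by (rule theI'[OF ex1_min_monomial_gens[OF assms]])
  hence G: "min_monomial_gens V I \<subseteq> monomials V"
      "Idl\<^bsub>mpoly_ring V\<^esub> (min_monomial_gens V I) = I"
    by (simp_all add: is_min_monomial_gens_def)
  then obtain S where S: "S \<subseteq> exponents V" "min_monomial_gens V I = monomial ` S"
    unfolding monomials_def by (meson subset_imageE)
  have I: "I = mspan V S"
    using S G(2) genideal_monomials[of S V, where 'k = 'k] by auto
  have "subst_one j ` (monomial ` S :: 'k mpoly set) = monomial ` Poly_Mapping.update j 0 ` S"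
    by (simp add: image_image subst_one_def)
  moreover have "Idl\<^bsub>mpoly_ring (V - {j})\<^esub> (monomial ` Poly_Mapping.update j 0 ` S) =
      (mspan (V - {j}) (Poly_Mapping.update j 0 ` S) :: 'k mpoly set)"
    using image_update_exponents[OF S(1)] by (intro genideal_monomials) blast
  ultimately have "contraction V j I = mspan (V - {j}) (Poly_Mapping.update j 0 ` S)"
    unfolding contraction_def S(2) by simp
  with S(1) I show thesis by (rule that)
qed

section \<open>Contraction of demotions\<close>

theorem corollary5p5:
  fixes I J :: "('k::field) mpoly set" and n j :: nat
  assumes "monomial_ideal {1..n} J"
    and "monomial_ideal {1..n} I"
    and "J \<subseteq> I"
    and "1 \<le> j" and "j \<le> n"
    and "demotion (mpoly_ring {1..n}) J I"
  shows "demotion (mpoly_ring ({1..n} - {j})) (contraction {1..n} j J) (contraction {1..n} j I)"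
proof -
  let ?V = "{1..n}" and ?u = "Poly_Mapping.update j (0::nat)"
  obtain S where S: "S \<subseteq> exponents ?V" "I = mspan ?V S"
      "contraction ?V j I = mspan (?V - {j}) (?u ` S)"
    by (rule contraction_mspan[OF assms(2)])
  obtain T where T: "T \<subseteq> exponents ?V" "J = mspan ?V T"
      "contraction ?V j J = mspan (?V - {j}) (?u ` T)"
    by (rule contraction_mspan[OF assms(1)])
  from assms(6) have sub: "T \<subseteq> S + UNIV"
    and dem: "\<And>r s m. Poly_Mapping.keys m \<subseteq> ?V \<Longrightarrow> m \<in> nfold_sum (r + s) S + UNIV \<Longrightarrow>
      m \<in> nfold_sum s T + UNIV \<Longrightarrow> m \<in> nfold_sum r S + nfold_sum s T + UNIV"
    unfolding S(2) T(2) demotion_mspan_iff[OF S(1) T(1)] by blast+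
  have usub: "?u ` T \<subseteq> ?u ` S + UNIV"
    using image_mono[OF sub, of ?u] set_plus_mono2[OF order_refl subset_UNIV]
    unfolding image_update_plus by blast
  have udem: "m \<in> nfold_sum r (?u ` S) + nfold_sum s (?u ` T) + UNIV"
    if m: "Poly_Mapping.keys m \<subseteq> ?V - {j}" "m \<in> nfold_sum (r + s) (?u ` S) + UNIV"
      "m \<in> nfold_sum s (?u ` T) + UNIV" for r s m
  proof -
    have j: "j \<notin> Poly_Mapping.keys m" using m(1) by blast
    obtain N N' where N: "m + Poly_Mapping.single j N \<in> nfold_sum (r + s) S + UNIV"
        "m + Poly_Mapping.single j N' \<in> nfold_sum s T + UNIV"
      using m(2,3) unfolding image_update_nfold_sum[symmetric] mem_image_update_iff[OF j] by blast
    \<comment> \<open>The two memberships may need different powers of \<open>x\<^sub>j\<close>; the sum of the exponents serves both.\<close>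
    have "m + Poly_Mapping.single j (N + N') \<in> nfold_sum r S + nfold_sum s T + UNIV"
    proof (rule dem)
      show "Poly_Mapping.keys (m + Poly_Mapping.single j (N + N')) \<subseteq> ?V"
        using m(1) assms(4,5) by (auto simp: keys_plus_nat)
      show "m + Poly_Mapping.single j (N + N') \<in> nfold_sum (r + s) S + UNIV"
        using mem_plus_UNIV_addI[OF N(1), of "Poly_Mapping.single j N'"]
        by (simp add: single_add add.assoc)
      show "m + Poly_Mapping.single j (N + N') \<in> nfold_sum s T + UNIV"
        using mem_plus_UNIV_addI[OF N(2), of "Poly_Mapping.single j N"]
        by (simp add: single_add ac_simps)
    qed
    thus ?thesis
      unfolding image_update_nfold_sum[symmetric] image_update_plus[symmetric]
        mem_image_update_iff[OF j] by blast
  qed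
  show ?thesis
    unfolding S(3) T(3) demotion_mspan_iff[OF image_update_exponents[OF S(1)]
      image_update_exponents[OF T(1)]]
    by (intro conjI allI impI usub udem)
qed

end
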